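(* Let $G=(V,E)$ be a finite graph, let $p=(p_e : e\in E)$ with $p_e\in(0,1)$ for every $e\in E$, let $\alpha\in(0,1)$, and let $q\ge 1$. Let $\phi=\phi_{p,q}$ be the random cluster measure on $\{0,1\}^E$ with parameters $p,q$, and let $\nu=\nu_{\phi,\alpha}$ be the corresponding fractional fuzzy Potts measure on $\{\pm1\}^V$. Then $\nu$ is positively associated; that is, for any two increasing events $A,B\subseteq\{\pm1\}^V$, $$\nu(A\cap B)\ge \nu(A)\,\nu(B).$$
   Context: Let $G=(V,E)$ be a finite graph. For $q>0$ and $p=(p_e:e\in E)$ with $p_e\in(0,1)$, the random cluster measure $\phi_{p,q}$ is the probability measure on $\{0,1\}^E$ given by $$\phi_{p,q}(\eta)\propto \Big(\prod_{e\in E}p_e^{\eta_e}(1-p_e)^{1-\eta_e}\Big)q^{k(\eta)},$$ where $\propto$ means "proportional to", an edge $e$ is called open if $\eta_e=1$, and $k(\eta)$ is the number of connected components ("clusters") of the graph with vertex set $V$ and edge set $\{e\in E:\eta_e=1\}$ (isolated vertices count as components). Configurations $\eta$ are identified with the corresponding subgraphs of $G$. For $\alpha\in(0,1)$ and $\phi=\phi_{p,q}$, the fractional fuzzy Potts measure $\nu_{\phi,\alpha}$ is the distribution on $\{\pm1\}^V$ of the random spin configuration $\sigma=(\sigma_v:v\in V)$ obtained as follows: (i) choose a random subgraph $\eta$ of $G$ with distribution $\phi$; (ii) given $\eta$, independently for each cluster of $\eta$ choose a spin, equal to $1$ with probability $\alpha$ and $-1$ with probability $1-\alpha$, and assign the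 spin of a cluster to each of its vertices. An event $A\subseteq\{\pm1\}^V$ is increasing if $\sigma\in A$ and $\sigma\le\sigma'$ coordinatewise imply $\sigma'\in A$. Two events $A,B$ are positively correlated if $\Pr(A\cap B)\ge\Pr(A)\Pr(B)$. *)

theory Defs
  imports "HOL-Probability.Probability"
begin

(* Undirected graphs on vertex set V with edge labels E and endpoint map ends.  Loops
   (card (ends e) = 1) and parallel edges are allowed; a simple graph with
   E a set of two-element subsets of V is the case ends = (\<lambda>e. e). *)

definition finite_graph :: "'v set \<Rightarrow> 'e set \<Rightarrow> ('e \<Rightarrow> 'v set) \<Rightarrow> bool" where
  "finite_graph V E ends \<longleftrightarrow>
     finite V \<and> finite E \<and> (\<forall>e\<in>E. ends e \<subseteq> V \<and> card (ends e) \<in> {1, 2})"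

definition edge_configs :: "'e set \<Rightarrow> ('e \<Rightarrow> nat) set" where
  "edge_configs E = E \<rightarrow>\<^sub>E {0, 1}"

definition open_adj :: "'e set \<Rightarrow> ('e \<Rightarrow> 'v set) \<Rightarrow> ('e \<Rightarrow> nat) \<Rightarrow> ('v \<times> 'v) set" where
  "open_adj E ends \<eta> = {(u, v). \<exists>e\<in>E. \<eta> e = 1 \<and> ends e = {u, v}}"

definition connected_rel ::
  "'v set \<Rightarrow> 'e set \<Rightarrow> ('e \<Rightarrow> 'v set) \<Rightarrow> ('e \<Rightarrow> nat) \<Rightarrow> ('v \<times> 'v) set" where
  "connected_rel V E ends \<eta> = {(u, v). u \<in> V \<and> v \<in> V \<and> (u, v) \<in> (open_adj E ends \<eta>)\<^sup>*}"

definition cluster ::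
  "'v set \<Rightarrow> 'e set \<Rightarrow> ('e \<Rightarrow> 'v set) \<Rightarrow> ('e \<Rightarrow> nat) \<Rightarrow> 'v \<Rightarrow> 'v set" where
  "cluster V E ends \<eta> v = connected_rel V E ends \<eta> `` {v}"

definition clusters ::
  "'v set \<Rightarrow> 'e set \<Rightarrow> ('e \<Rightarrow> 'v set) \<Rightarrow> ('e \<Rightarrow> nat) \<Rightarrow> 'v set set" where
  "clusters V E ends \<eta> = V // connected_rel V E ends \<eta>"

definition rc_weight ::
  "'v set \<Rightarrow> 'e set \<Rightarrow> ('e \<Rightarrow> 'v set) \<Rightarrow> ('e \<Rightarrow> real) \<Rightarrow> real \<Rightarrow> ('e \<Rightarrow> nat) \<Rightarrow> real" where
  "rc_weight V E ends p q \<eta> =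
     (\<Prod>e\<in>E. p e ^ \<eta> e * (1 - p e) ^ (1 - \<eta> e)) * q ^ card (clusters V E ends \<eta>)"

(* embed_pmf is only meaningful for nonnegative functions of total mass 1; see
   pmf_random_cluster below for the parameters of interest. *)

definition random_cluster ::
  "'v set \<Rightarrow> 'e set \<Rightarrow> ('e \<Rightarrow> 'v set) \<Rightarrow> ('e \<Rightarrow> real) \<Rightarrow> real \<Rightarrow> ('e \<Rightarrow> nat) pmf" where
  "random_cluster V E ends p q = embed_pmf (\<lambda>\<eta>.
     if \<eta> \<in> edge_configs E
     then rc_weight V E ends p q \<eta> / (\<Sum>\<omega>\<in>edge_configs E. rc_weight V E ends p q \<omega>)
     else 0)"

definition spin_pmf :: "real \<Rightarrow> int pmf" where
  "spin_pmf \<alpha> = map_pmf (\<lambda>b. if b then 1 else -1) (bernoulli_pmf \<alpha>)"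

definition fuzzy_potts ::
  "'v set \<Rightarrow> 'e set \<Rightarrow> ('e \<Rightarrow> 'v set) \<Rightarrow> ('e \<Rightarrow> nat) pmf \<Rightarrow> real \<Rightarrow> ('v \<Rightarrow> int) pmf" where
  "fuzzy_potts V E ends \<phi> \<alpha> =
     bind_pmf \<phi> (\<lambda>\<eta>.
     map_pmf (\<lambda>s. \<lambda>v\<in>V. s (cluster V E ends \<eta> v))
       (Pi_pmf (clusters V E ends \<eta>) undefined (\<lambda>_. spin_pmf \<alpha>)))"

definition spin_configs :: "'v set \<Rightarrow> ('v \<Rightarrow> int) set" where
  "spin_configs V = V \<rightarrow>\<^sub>E {-1, 1}"

definition increasing_event :: "'v set \<Rightarrow> ('v \<Rightarrow> int) set \<Rightarrow> bool" where
  "increasing_event V A \<longleftrightarrow> A \<subseteq> spin_configs V \<and>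
     (\<forall>\<sigma>\<in>A. \<forall>\<sigma>'\<in>spin_configs V. (\<forall>v\<in>V. \<sigma> v \<le> \<sigma>' v) \<longrightarrow> \<sigma>' \<in> A)"

definition positively_associated :: "'v set \<Rightarrow> ('v \<Rightarrow> int) pmf \<Rightarrow> bool" where
  "positively_associated V \<nu> \<longleftrightarrow>
     (\<forall>A B. increasing_event V A \<longrightarrow> increasing_event V B \<longrightarrow>
        measure_pmf.prob \<nu> (A \<inter> B) \<ge> measure_pmf.prob \<nu> A * measure_pmf.prob \<nu> B)"

lemma finite_edge_configs: "finite E \<Longrightarrow> finite (edge_configs E)"
  by (simp add: edge_configs_def finite_PiE)

lemma edge_configs_nonempty: "edge_configs E \<noteq> {}"
  by (simp add: edge_configs_def PiE_eq_empty_iff)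

lemma rc_weight_pos:
  assumes "\<And>e. e \<in> E \<Longrightarrow> 0 < p e \<and> p e < 1" "q > 0"
  shows "rc_weight V E ends p q \<eta> > 0"
  using assms by (auto simp: rc_weight_def intro!: mult_pos_pos prod_pos zero_less_power)

lemma pmf_random_cluster:
  assumes "finite_graph V E ends" "\<And>e. e \<in> E \<Longrightarrow> 0 < p e \<and> p e < 1" "q > 0"
  shows "pmf (random_cluster V E ends p q) \<eta> =
    (if \<eta> \<in> edge_configs E
     then rc_weight V E ends p q \<eta> / (\<Sum>\<omega>\<in>edge_configs E. rc_weight V E ends p q \<omega>)
     else 0)"
proof -
  let ?w = "rc_weight V E ends p q" and ?C = "edge_configs E"
  let ?f = "\<lambda>\<eta>. if \<eta> \<in> ?C then ?w \<eta> / sum ?w ?C else 0"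
  have fin: "finite ?C"
    using assms(1) by (simp add: finite_graph_def finite_edge_configs)
  have w: "?w \<eta> > 0" for \<eta>
    using assms(2,3) by (rule rc_weight_pos)
  have Z: "sum ?w ?C > 0"
    using fin edge_configs_nonempty w by (rule sum_pos)
  have nonneg: "?f \<eta> \<ge> 0" for \<eta>
    using w[of \<eta>] Z by simp
  have "(\<integral>\<^sup>+ \<eta>. ennreal (?f \<eta>) \<partial>count_space UNIV) = (\<Sum>\<eta>\<in>?C. ennreal (?f \<eta>))"
    using fin by (intro nn_integral_count_space') auto
  also have "\<dots> = ennreal (\<Sum>\<eta>\<in>?C. ?f \<eta>)"
    by (rule sum_ennreal) (rule nonneg)
  also have "(\<Sum>\<eta>\<in>?C. ?f \<eta>) = 1"
    using Z by (simp flip: sum_divide_distrib)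
  finally have "(\<integral>\<^sup>+ \<eta>. ennreal (?f \<eta>) \<partial>count_space UNIV) = 1"
    by simp
  then show ?thesis
    unfolding random_cluster_def by (rule pmf_embed_pmf[OF nonneg])
qed

lemma equiv_connected_rel: "equiv V (connected_rel V E ends \<eta>)"
proof (rule equivI)
  have "sym (open_adj E ends \<eta>)"
    by (auto simp: sym_def open_adj_def insert_commute)
  then have "sym ((open_adj E ends \<eta>)\<^sup>*)"
    by (rule sym_rtrancl)
  then show "sym (connected_rel V E ends \<eta>)"
    by (auto simp: sym_def connected_rel_def)
qed (auto simp: refl_on_def trans_def connected_rel_def intro: rtrancl_trans)

end

theory Submission
  imports Defs
begin

text \<open>
A configuration is encoded by the set \<open>\<omega>\<close> of its open edges and a spin assignment by the set \<open>P\<close> of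
its plus vertices, so that an increasing event becomes an increasing function of \<open>P\<close>. Given \<open>\<omega>\<close>, the
spins of the clusters are independent, hence positively correlated. This alone does not settle the
matter, because the conditional average of an increasing function of the spins is not monotone in
\<open>\<omega>\<close>: opening an edge makes "all spins are plus" more likely and "some spin is plus" less likely.

The way out is to look only at edges that touch the cluster of a root vertex \<open>r\<close> whose spin is known.
If that spin is plus, then opening such an edge stochastically increases the spins
(\<open>plus_mean_open\<close>). For this, fix the states of some edges and reveal the remaining edges at
the cluster of \<open>r\<close> one by one. Opening one edge makes the other ones more likely to be open, since
\<open>q \<ge> 1\<close> (\<open>total_mass_supermodular\<close>), and both outcomes are handled by induction on the number of
undecided edges. When no undecided edge touches the cluster of \<open>r\<close>, opening \<open>e\<close> merely appends the
cluster of the other end \<open>u\<close> of \<open>e\<close> to it. As \<open>u\<close> is connected to \<open>r\<close> in either all or none of the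
configurations left, all their weights change by one common factor. The law of the undecided edges is
therefore the same as with \<open>e\<close> closed, and the spins change only in that the cluster of \<open>u\<close> is now
plus.

Positive correlation follows by a second induction on the number of undecided edges, run
simultaneously for the spins without conditioning and for the spins conditioned on a plus root
(\<open>free_and_plus_correlation\<close>). A mixture of two positively correlated laws of which one dominates
the other is positively correlated (\<open>mixture_correlation\<close>). With a plus root, mix over the state of
an undecided edge at its cluster; \<open>plus_mean_open\<close> is the domination. If there is no such edge, the
cluster of the root is deterministic, and setting it to plus is an increasing operation on the
unconditioned spins. Without conditioning, pick a root at an undecided edge and mix over its spin;
here domination is clear, since the spin of the root is independent of \<open>\<omega>\<close>. The case of a minus
root is that of a plus root with the two spins exchanged and \<open>\<alpha>\<close> replaced by \<open>1 - \<alpha>\<close>, so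
the induction ranges over all \<open>\<alpha>\<close>.
\<close>


section \<open>Averages over independent cluster spins\<close>

text \<open>
The members of \<open>K\<close> play the clusters, \<open>S\<close> the clusters of spin plus, and \<open>\<Union>S\<close> the set of plus
vertices.
\<close>

definition spin_mean :: "real \<Rightarrow> 'v set set \<Rightarrow> ('v set \<Rightarrow> real) \<Rightarrow> real" where
  "spin_mean \<alpha> K f = (\<Sum>S\<in>Pow K. \<alpha> ^ card S * (1 - \<alpha>) ^ card (K - S) * f (\<Union>S))"

lemma sum_Pow_insert:
  fixes h :: "'a set \<Rightarrow> real"
  assumes "finite U" "e \<notin> U"
  shows "(\<Sum>S\<in>Pow (insert e U). h S) = (\<Sum>S\<in>Pow U. h (insert e S)) + (\<Sum>S\<in>Pow U. h S)"
proof -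
  have "inj_on (insert e) (Pow U)"
    using assms(2) by (auto simp: inj_on_def)
  then have "sum h (insert e ` Pow U) = (\<Sum>S\<in>Pow U. h (insert e S))"
    by (simp add: sum.reindex)
  moreover have "sum h (Pow U \<union> insert e ` Pow U) = sum h (Pow U) + sum h (insert e ` Pow U)"
    using assms by (intro sum.union_disjoint) auto
  ultimately show ?thesis
    by (simp add: Pow_insert)
qed

lemma spin_mean_empty [simp]: "spin_mean \<alpha> {} f = f {}"
  by (simp add: spin_mean_def)

lemma spin_mean_insert:
  assumes "finite K" "C \<notin> K"
  shows "spin_mean \<alpha> (insert C K) f =
    \<alpha> * spin_mean \<alpha> K (\<lambda>P. f (P \<union> C)) + (1 - \<alpha>) * spin_mean \<alpha> K f"
proof -
  have "card (insert C S) = Suc (card S)" "insert C K - insert C S = K - S"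
    "card (insert C K - S) = Suc (card (K - S))" if "S \<subseteq> K" for S
  proof -
    have "finite S" "C \<notin> S"
      using that assms finite_subset by auto
    then show "card (insert C S) = Suc (card S)"
      by simp
    show "insert C K - insert C S = K - S"
      using assms(2) by auto
    have "insert C K - S = insert C (K - S)"
      using \<open>C \<notin> S\<close> by auto
    then show "card (insert C K - S) = Suc (card (K - S))"
      using assms by simp
  qed
  then show ?thesis
    unfolding spin_mean_def sum_Pow_insert[OF assms] sum_distrib_left
    by (intro arg_cong2[where f = "(+)"] sum.cong) (auto simp: Un_commute)
qed

lemma spin_mean_cong:
  assumes "\<And>P. P \<subseteq> \<Union>K \<Longrightarrow> f P = g P"
  shows "spin_mean \<alpha> K f = spin_mean \<alpha> K g"
  unfolding spin_mean_def using assms by (intro sum.cong) (auto simp: Union_mono)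

lemma spin_mean_mono:
  assumes "0 < \<alpha>" "\<alpha> < 1" "\<And>P. P \<subseteq> \<Union>K \<Longrightarrow> f P \<le> g P"
  shows "spin_mean \<alpha> K f \<le> spin_mean \<alpha> K g"
  unfolding spin_mean_def using assms by (intro sum_mono mult_left_mono) (auto simp: Union_mono)

lemma spin_mean_uminus: "spin_mean \<alpha> K (\<lambda>P. - f P) = - spin_mean \<alpha> K f"
  by (simp add: spin_mean_def sum_negf)

text \<open>
If all vertices of \<open>A\<close> are set to plus, the spins of the members inside \<open>A\<close> average out. Two partitions
that differ only inside \<open>A\<close> thus give the same average.
\<close>

lemma spin_mean_absorb:
  assumes "finite K"
  shows "spin_mean \<alpha> K (\<lambda>P. f (P \<union> A)) = spin_mean \<alpha> {D \<in> K. \<not> D \<subseteq> A} (\<lambda>P. f (P \<union> A))"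
  using assms
proof (induction K arbitrary: f rule: finite_induct)
  case (insert D K)
  let ?K = "{X \<in> K. \<not> X \<subseteq> A}"
  show ?case
  proof (cases "D \<subseteq> A")
    case True
    then have "P \<union> D \<union> A = P \<union> A" for P
      by blast
    then have "spin_mean \<alpha> (insert D K) (\<lambda>P. f (P \<union> A)) = spin_mean \<alpha> K (\<lambda>P. f (P \<union> A))"
      by (simp add: spin_mean_insert[OF insert.hyps] flip: distrib_right)
    also have "\<dots> = spin_mean \<alpha> ?K (\<lambda>P. f (P \<union> A))"
      by (rule insert.IH)
    also have "?K = {X \<in> insert D K. \<not> X \<subseteq> A}"
      using True by auto
    finally show ?thesis .
  next
    case False
    have swap: "P \<union> D \<union> A = P \<union> A \<union> D" for P
      by blast
    have "{X \<in> insert D K. \<not> X \<subseteq> A} = insert D ?K"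
      using False by auto
    moreover have "spin_mean \<alpha> (insert D L) (\<lambda>P. f (P \<union> A)) =
        \<alpha> * spin_mean \<alpha> L (\<lambda>P. f (P \<union> A \<union> D)) + (1 - \<alpha>) * spin_mean \<alpha> L (\<lambda>P. f (P \<union> A))"
      if "L \<in> {K, ?K}" for L
    proof -
      have "finite L" "D \<notin> L"
        using that insert.hyps by auto
      from spin_mean_insert[OF this, of \<alpha> "\<lambda>P. f (P \<union> A)"] show ?thesis
        by (simp only: swap)
    qed
    ultimately show ?thesis
      by (simp only: insert.IH[of f] insert.IH[of "\<lambda>Q. f (Q \<union> D)"] insert_iff simp_thms)
  qed
qed auto

text \<open>
Conditioning on the spin of \<open>C\<close> amounts to overwriting that spin, as it is independent of the others.
\<close>

lemma spin_mean_split: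
  assumes "finite K" "disjoint K" "C \<in> K"
  shows "spin_mean \<alpha> K f =
    \<alpha> * spin_mean \<alpha> K (\<lambda>P. f (P \<union> C)) + (1 - \<alpha>) * spin_mean \<alpha> K (\<lambda>P. f (P - C))"
proof -
  define L where "L = K - {C}"
  have L: "finite L" "C \<notin> L" "K = insert C L"
    using assms by (auto simp: L_def)
  have "D \<inter> C = {}" if "D \<in> L" for D
    using that assms by (auto simp: L_def disjoint_def)
  then have "P - C = P" if "P \<subseteq> \<Union>L" for P
    using that by blast
  then have "spin_mean \<alpha> L (\<lambda>P. f (P - C)) = spin_mean \<alpha> L f"
    by (intro spin_mean_cong) simp
  moreover have "spin_mean \<alpha> L (\<lambda>P. f (P \<union> C - C)) = spin_mean \<alpha> L (\<lambda>P. f (P - C))"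
    by (intro spin_mean_cong) (simp add: Un_Diff)
  ultimately show ?thesis
    by (simp add: L spin_mean_insert Un_assoc) (simp add: algebra_simps)
qed

text \<open>
Exchanging the spins turns increasing functions into decreasing ones and plus roots into minus roots,
which halves the number of monotonicity arguments.
\<close>

lemma spin_mean_flip:
  assumes "finite K" "disjoint K"
  shows "spin_mean \<alpha> K f = spin_mean (1 - \<alpha>) K (\<lambda>P. f (\<Union>K - P))"
proof -
  have "\<Union>K - \<Union>(K - S) = \<Union>S" if "S \<subseteq> K" for S
    using that assms(2) by (fastforce simp: disjoint_def)
  then show ?thesis
    unfolding spin_mean_def
    by (intro sum.reindex_bij_witness[of _ "\<lambda>S. K - S" "\<lambda>S. K - S"])
       (auto simp: double_diff mult_ac)
qed

lemma mono_on_Un: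
  assumes "mono_on (Pow V) (f :: 'v set \<Rightarrow> real)" "C \<subseteq> V"
  shows "mono_on (Pow V) (\<lambda>P. f (P \<union> C))"
  using assms(2) by (intro mono_onI mono_onD[OF assms(1)]) auto

text \<open>
The covariance under a mixture is the mixture of the covariances plus \<open>s (1 - s)\<close> times the product of
the two differences of means; domination of one component by the other makes these differences have
the same sign.
\<close>

lemma mixture_correlation:
  fixes s :: real
  assumes "0 \<le> s" "s \<le> 1" "x0 \<le> x1" "y0 \<le> y1" "x1 * y1 \<le> z1" "x0 * y0 \<le> z0"
  shows "(s * x1 + (1 - s) * x0) * (s * y1 + (1 - s) * y0) \<le> s * z1 + (1 - s) * z0"
proof -
  have "0 \<le> (s * (1 - s)) * ((x1 - x0) * (y1 - y0))"
    using assms by simp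
  then have "(s * x1 + (1 - s) * x0) * (s * y1 + (1 - s) * y0)
      \<le> s * (x1 * y1) + (1 - s) * (x0 * y0)"
    by (simp add: algebra_simps)
  also have "\<dots> \<le> s * z1 + (1 - s) * z0"
    using assms by (intro add_mono mult_left_mono) auto
  finally show ?thesis .
qed

text \<open>
Harris' inequality for the independent spins of the members of \<open>K\<close>: revealing one of them gives a
mixture in which the law with the plus spin dominates.
\<close>

lemma spin_mean_correlation:
  assumes "finite K" "\<Union>K \<subseteq> V" "0 < \<alpha>" "\<alpha> < 1" "mono_on (Pow V) f" "mono_on (Pow V) g"
  shows "spin_mean \<alpha> K f * spin_mean \<alpha> K g \<le> spin_mean \<alpha> K (\<lambda>P. f P * g P)"
  using assms(1,2,5,6)
proof (induction K arbitrary: f g rule: finite_induct)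
  case (insert C K)
  have dom: "spin_mean \<alpha> K h \<le> spin_mean \<alpha> K (\<lambda>P. h (P \<union> C))" if "mono_on (Pow V) h" for h
    using insert.prems(1) by (intro spin_mean_mono assms mono_onD[OF that]) auto
  show ?case
    unfolding spin_mean_insert[OF insert.hyps]
    using insert.prems assms(3,4)
    by (intro mixture_correlation dom insert.IH mono_on_Un) auto
qed simp


definition plus_config :: "'v set \<Rightarrow> 'v set \<Rightarrow> 'v \<Rightarrow> int" where
  "plus_config V P = (\<lambda>v\<in>V. if v \<in> P then 1 else -1)"

lemma mono_on_indicator_plus_config:
  fixes V :: "'v set"
  assumes "increasing_event V A"
  shows "mono_on (Pow V) (\<lambda>P. indicat_real A (plus_config V P))"
proof (rule mono_onI)
  fix P Q :: "'v set" assume "P \<subseteq> Q"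
  then have "\<forall>v\<in>V. plus_config V P v \<le> plus_config V Q v"
    by (auto simp: plus_config_def)
  moreover have "plus_config V Q \<in> spin_configs V"
    by (auto simp: plus_config_def spin_configs_def)
  ultimately have "plus_config V Q \<in> A" if "plus_config V P \<in> A"
    using assms that unfolding increasing_event_def by blast
  then show "indicat_real A (plus_config V P) \<le> indicat_real A (plus_config V Q)"
    by (auto simp: indicator_def)
qed

lemma expectation_cluster_spins:
  fixes f :: "'v set \<Rightarrow> real"
  assumes "finite K" "0 < \<alpha>" "\<alpha> < 1"
  shows "measure_pmf.expectation (Pi_pmf K undefined (\<lambda>_. spin_pmf \<alpha>))
    (\<lambda>s. f (\<Union>{C \<in> K. s C = 1})) = spin_mean \<alpha> K f"
  using assms(1)
proof (induction K arbitrary: f rule: finite_induct)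
  case (insert C K)
  let ?Pi = "\<lambda>K. Pi_pmf K undefined (\<lambda>_. spin_pmf \<alpha>)" and ?s = "\<lambda>b. if b then 1 else - 1 :: int"
  have fin: "finite (set_pmf (?Pi K))"
    using insert.hyps(1) by (auto simp: set_Pi_pmf spin_pmf_def intro!: finite_PiE_dflt)
  have Pi: "?Pi (insert C K) = bernoulli_pmf \<alpha> \<bind> (\<lambda>b. map_pmf (\<lambda>s. s(C := ?s b)) (?Pi K))"
    unfolding Pi_pmf_insert'[OF insert.hyps] spin_pmf_def bind_map_pmf map_pmf_def[symmetric] ..
  have plus: "\<Union>{D \<in> insert C K. (s(C := ?s b)) D = 1} =
      (if b then \<Union>{D \<in> K. s D = 1} \<union> C else \<Union>{D \<in> K. s D = 1})"
    for s b
  proof -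
    have "{D \<in> insert C K. (s(C := ?s b)) D = 1} =
        (if b then insert C {D \<in> K. s D = 1} else {D \<in> K. s D = 1})"
      using insert.hyps(2) by auto
    then show ?thesis
      by auto
  qed
  have "measure_pmf.expectation (?Pi (insert C K)) (\<lambda>s. f (\<Union>{D \<in> insert C K. s D = 1})) =
      (\<Sum>b\<in>UNIV. pmf (bernoulli_pmf \<alpha>) b *
        measure_pmf.expectation (?Pi K) (\<lambda>s. f (\<Union>{D \<in> insert C K. (s(C := ?s b)) D = 1})))"
    unfolding Pi using fin by (subst pmf_expectation_bind[of UNIV]) auto
  also have "\<dots> = spin_mean \<alpha> (insert C K) f"
    unfolding plus spin_mean_insert[OF insert.hyps]
    using assms(2,3) insert.IH[of f] insert.IH[of "\<lambda>P. f (P \<union> C)"] by (simp add: UNIV_bool)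
  finally show ?case .
qed simp


section \<open>Opening one edge\<close>

locale random_cluster_graph =
  fixes V :: "'v set" and E :: "'e set" and ends :: "'e \<Rightarrow> 'v set"
    and p :: "'e \<Rightarrow> real" and q :: real
  assumes graph: "finite_graph V E ends"
    and p: "\<And>e. e \<in> E \<Longrightarrow> 0 < p e \<and> p e < 1"
    and q: "1 \<le> q"
begin

text \<open>
A set \<open>\<omega>\<close> of open edges is viewed as the graph with edge set \<open>\<omega>\<close> and all edges open. The state of
an open edge is written \<open>Suc 0\<close>, the normal form of \<open>1\<close> under simplification.
\<close>

abbreviation conn :: "'e set \<Rightarrow> ('v \<times> 'v) set" where
  "conn \<omega> \<equiv> connected_rel V \<omega> ends (\<lambda>_. Suc 0)"

abbreviation comp :: "'e set \<Rightarrow> 'v \<Rightarrow> 'v set" where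
  "comp \<omega> \<equiv> cluster V \<omega> ends (\<lambda>_. Suc 0)"

abbreviation comps :: "'e set \<Rightarrow> 'v set set" where
  "comps \<omega> \<equiv> clusters V \<omega> ends (\<lambda>_. Suc 0)"

lemma finite_V: "finite V" and finite_edges: "\<omega> \<subseteq> E \<Longrightarrow> finite \<omega>"
  using graph by (auto simp: finite_graph_def intro: finite_subset)

lemma edge_ends:
  assumes "e \<in> E"
  obtains u v where "u \<in> V" "v \<in> V" "ends e = {u, v}"
proof -
  have "ends e \<subseteq> V" "card (ends e) = 1 \<or> card (ends e) = 2"
    using graph assms by (auto simp: finite_graph_def)
  then show ?thesis
    by (metis that card_1_singletonE card_2_iff insert_absorb2 insert_subset)
qed

lemma comps_eq: "comps \<omega> = comp \<omega> ` V"
  by (auto simp: clusters_def cluster_def quotient_def)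

lemma finite_comps: "finite (comps \<omega>)"
  using finite_V by (simp add: comps_eq)

lemma disjoint_comps: "disjoint (comps \<omega>)"
  unfolding clusters_def disjoint_def
  using quotient_disj[OF equiv_connected_rel[of V \<omega> ends "\<lambda>_. Suc 0"]] by blast

lemma Union_comps: "\<Union>(comps \<omega>) = V"
  unfolding clusters_def by (rule Union_quotient[OF equiv_connected_rel])

lemma comp_subset: "comp \<omega> v \<subseteq> V"
  by (auto simp: cluster_def connected_rel_def)

lemma comp_self: "v \<in> V \<Longrightarrow> v \<in> comp \<omega> v"
  by (simp add: cluster_def connected_rel_def)

lemma comp_iff: "u \<in> V \<Longrightarrow> v \<in> V \<Longrightarrow> v \<in> comp \<omega> u \<longleftrightarrow> comp \<omega> u = comp \<omega> v"
  unfolding cluster_def using eq_equiv_class_iff[OF equiv_connected_rel[of V \<omega> ends "\<lambda>_. Suc 0"]]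
  by auto

lemma conn_mono: "\<omega> \<subseteq> \<omega>' \<Longrightarrow> conn \<omega> \<subseteq> conn \<omega>'"
proof -
  assume "\<omega> \<subseteq> \<omega>'"
  then have "open_adj \<omega> ends (\<lambda>_. Suc 0) \<subseteq> open_adj \<omega>' ends (\<lambda>_. Suc 0)"
    by (auto simp: open_adj_def)
  from rtrancl_mono[OF this] show ?thesis
    by (auto simp: connected_rel_def)
qed

lemma comp_mono: "\<omega> \<subseteq> \<omega>' \<Longrightarrow> comp \<omega> v \<subseteq> comp \<omega>' v"
  using conn_mono[of \<omega> \<omega>'] by (auto simp: cluster_def)

lemma comp_insert:
  assumes "ends e = {u, v}" "u \<in> V" "v \<in> V" "w \<in> V"
  shows "comp (insert e \<omega>) w =
    (if w \<in> comp \<omega> u \<union> comp \<omega> v then comp \<omega> u \<union> comp \<omega> v else comp \<omega> w)"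
proof -
  let ?A = "open_adj \<omega> ends (\<lambda>_. Suc 0)"
  have adj: "open_adj (insert e \<omega>) ends (\<lambda>_. Suc 0) = insert (u, v) (insert (v, u) ?A)"
    using assms(1) by (auto simp: open_adj_def doubleton_eq_iff)
  have "sym ?A"
    by (auto simp: sym_def open_adj_def insert_commute)
  then have sym: "(a, b) \<in> ?A\<^sup>* \<longleftrightarrow> (b, a) \<in> ?A\<^sup>*" for a b
    using sym_rtrancl symD by metis
  have "comp (insert e \<omega>) w = comp \<omega> w \<union>
      (if w \<in> comp \<omega> u \<union> comp \<omega> v then comp \<omega> u \<union> comp \<omega> v else {})"
    using assms unfolding cluster_def connected_rel_def adj rtrancl_insert
    by (auto simp: sym[of w] intro: rtrancl_trans)
  moreover have "comp \<omega> w = comp \<omega> u" if "w \<in> comp \<omega> u"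
    using that comp_iff assms by blast
  moreover have "comp \<omega> w = comp \<omega> v" if "w \<in> comp \<omega> v"
    using that comp_iff assms by blast
  ultimately show ?thesis
    by auto
qed

text \<open>
Stated so as to cover also an edge whose ends are already connected: in that case the cluster removed
is the one put back.
\<close>

lemma comps_insert:
  assumes "ends e = {u, v}" "u \<in> V" "v \<in> V"
  shows "comps (insert e \<omega>) = insert (comp \<omega> u \<union> comp \<omega> v) (comps \<omega> - {comp \<omega> u, comp \<omega> v})"
proof -
  have "w \<in> comp \<omega> u \<union> comp \<omega> v \<longleftrightarrow> comp \<omega> w \<in> {comp \<omega> u, comp \<omega> v}" if "w \<in> V" for w
    using comp_iff that assms by auto
  then show ?thesis
    unfolding comps_eq using assms comp_self[OF assms(2), of \<omega>]
    by (auto simp: comp_insert[OF assms] image_iff split: if_splits)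
qed

text \<open>
The random cluster weight divided by the constant \<open>\<Prod>e\<in>E. 1 - p e\<close>. In this normalisation it is defined
without reference to the closed edges, which suits configurations that are built up edge by edge.
\<close>

definition rc_mass :: "'e set \<Rightarrow> real" where
  "rc_mass \<omega> = (\<Prod>e\<in>\<omega>. p e / (1 - p e)) * q ^ card (comps \<omega>)"

text \<open>
The factor by which the weight changes when the closed edge \<open>e\<close> is opened: a cluster is lost, and
with it a factor \<open>q\<close>, exactly if the ends of \<open>e\<close> are not yet connected.
\<close>

definition open_ratio :: "'e \<Rightarrow> 'e set \<Rightarrow> real" where
  "open_ratio e \<omega> = p e / (1 - p e) * (if ends e \<times> ends e \<subseteq> conn \<omega> then 1 else 1 / q)"

lemma rc_mass_pos: "\<omega> \<subseteq> E \<Longrightarrow> 0 < rc_mass \<omega>"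
  using p q by (auto simp: rc_mass_def subset_iff intro!: mult_pos_pos prod_pos divide_pos_pos)

lemma open_ratio_pos: "e \<in> E \<Longrightarrow> 0 < open_ratio e \<omega>"
  using p[of e] q by (simp add: open_ratio_def)

text \<open>
The point where \<open>q \<ge> 1\<close> enters: the more edges are open, the cheaper it is to open another one.
\<close>

lemma open_ratio_mono:
  assumes "e \<in> E" "\<omega> \<subseteq> \<omega>'"
  shows "open_ratio e \<omega> \<le> open_ratio e \<omega>'"
proof -
  have "0 < p e / (1 - p e)"
    using p[OF assms(1)] by simp
  then show ?thesis
    unfolding open_ratio_def using conn_mono[OF assms(2)] q
    by (intro mult_left_mono) auto
qed

lemma ends_connected_iff:
  assumes "ends e = {u, v}" "u \<in> V" "v \<in> V"
  shows "ends e \<times> ends e \<subseteq> conn \<omega> \<longleftrightarrow> v \<in> comp \<omega> u"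
proof -
  have "equiv V (conn \<omega>)"
    by (rule equiv_connected_rel)
  then show ?thesis
    using assms unfolding cluster_def equiv_def refl_on_def sym_def by auto
qed

lemma rc_mass_insert:
  assumes "e \<in> E" "\<omega> \<subseteq> E" "e \<notin> \<omega>"
  shows "rc_mass (insert e \<omega>) = open_ratio e \<omega> * rc_mass \<omega>"
proof -
  obtain u v where uv: "u \<in> V" "v \<in> V" "ends e = {u, v}"
    using edge_ends[OF assms(1)] .
  let ?u = "comp \<omega> u" and ?v = "comp \<omega> v"
  have in_comps: "?u \<in> comps \<omega>" "?v \<in> comps \<omega>"
    using uv by (auto simp: comps_eq)
  have "finite \<omega>"
    using assms(2) by (rule finite_edges)
  moreover have "q ^ card (comps (insert e \<omega>)) =
      (if ends e \<times> ends e \<subseteq> conn \<omega> then 1 else 1 / q) * q ^ card (comps \<omega>)"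
  proof (cases "v \<in> ?u")
    case True
    then have "?u = ?v"
      using comp_iff uv by simp
    then have "comps (insert e \<omega>) = comps \<omega>"
      using comps_insert[OF uv(3,1,2), of \<omega>] in_comps by auto
    then show ?thesis
      using True ends_connected_iff uv by simp
  next
    case False
    then have ne: "?u \<noteq> ?v"
      using comp_iff uv by simp
    have "?u \<union> ?v \<notin> comps \<omega>"
    proof
      assume "?u \<union> ?v \<in> comps \<omega>"
      then obtain w where "w \<in> V" "?u \<union> ?v = comp \<omega> w"
        by (auto simp: comps_eq)
      then show False
        using ne comp_iff uv comp_self by blast
    qed
    then have "card (comps (insert e \<omega>)) = Suc (card (comps \<omega> - {?u, ?v}))"
      unfolding comps_insert[OF uv(3,1,2)] using finite_comps by simp
    moreover have "card (comps \<omega> - {?u, ?v}) = card (comps \<omega>) - 2"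
      using ne in_comps by (subst card_Diff_subset) auto
    moreover have "2 \<le> card (comps \<omega>)"
      using ne in_comps card_mono[OF finite_comps, of "{?u, ?v}" \<omega>] by auto
    ultimately have "card (comps \<omega>) = Suc (card (comps (insert e \<omega>)))"
      by simp
    then show ?thesis
      using False ends_connected_iff uv q by simp
  qed
  ultimately show ?thesis
    using assms(3) by (simp add: rc_mass_def open_ratio_def)
qed


section \<open>Conditional random cluster averages\<close>

text \<open>
The edges of \<open>B\<close> are open, those of \<open>U\<close> are undecided and all others are closed. Conditioning on the
state of an undecided edge leads from \<open>(B, insert e U)\<close> to \<open>(insert e B, U)\<close> or \<open>(B, U)\<close>, so this family
of conditional measures is closed under revealing edges.
\<close>

definition total_mass :: "'e set \<Rightarrow> 'e set \<Rightarrow> real" where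
  "total_mass B U = (\<Sum>\<eta>\<in>Pow U. rc_mass (B \<union> \<eta>))"

definition cond_mean :: "'e set \<Rightarrow> 'e set \<Rightarrow> ('e set \<Rightarrow> real) \<Rightarrow> real" where
  "cond_mean B U F = (\<Sum>\<eta>\<in>Pow U. rc_mass (B \<union> \<eta>) * F (B \<union> \<eta>)) / total_mass B U"

lemma total_mass_pos:
  assumes "B \<subseteq> E" "U \<subseteq> E"
  shows "0 < total_mass B U"
  unfolding total_mass_def using assms finite_edges[OF assms(2)]
  by (intro sum_pos rc_mass_pos) auto

lemma cond_mean_empty: "B \<subseteq> E \<Longrightarrow> cond_mean B {} F = F B"
  using rc_mass_pos[of B] by (simp add: cond_mean_def total_mass_def)

lemma cond_mean_cong:
  assumes "\<And>\<eta>. \<eta> \<subseteq> U \<Longrightarrow> F (B \<union> \<eta>) = G (B \<union> \<eta>)"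
  shows "cond_mean B U F = cond_mean B U G"
  unfolding cond_mean_def using assms by simp

lemma cond_mean_mono:
  assumes "B \<subseteq> E" "U \<subseteq> E" "\<And>\<eta>. \<eta> \<subseteq> U \<Longrightarrow> F (B \<union> \<eta>) \<le> G (B \<union> \<eta>)"
  shows "cond_mean B U F \<le> cond_mean B U G"
proof -
  have "0 < rc_mass (B \<union> \<eta>)" if "\<eta> \<subseteq> U" for \<eta>
    using that assms by (intro rc_mass_pos) auto
  then show ?thesis
    unfolding cond_mean_def using total_mass_pos[OF assms(1,2)] assms(3)
    by (intro divide_right_mono sum_mono mult_left_mono) (auto simp: less_imp_le)
qed

lemma cond_mean_linear:
  "cond_mean B U (\<lambda>\<omega>. a * F \<omega> + b * G \<omega>) = a * cond_mean B U F + b * cond_mean B U G"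
proof -
  have "(\<Sum>\<eta>\<in>Pow U. rc_mass (B \<union> \<eta>) * (a * F (B \<union> \<eta>) + b * G (B \<union> \<eta>))) =
      a * (\<Sum>\<eta>\<in>Pow U. rc_mass (B \<union> \<eta>) * F (B \<union> \<eta>))
      + b * (\<Sum>\<eta>\<in>Pow U. rc_mass (B \<union> \<eta>) * G (B \<union> \<eta>))"
    by (simp add: sum_distrib_left distrib_left mult.left_commute flip: sum.distrib)
  then show ?thesis
    by (simp add: cond_mean_def add_divide_distrib)
qed

lemma cond_mean_uminus: "cond_mean B U (\<lambda>\<omega>. - F \<omega>) = - cond_mean B U F"
  by (simp add: cond_mean_def sum_negf)

lemma total_mass_split:
  assumes "finite U" "e \<notin> U"
  shows "total_mass B (insert e U) = total_mass (insert e B) U + total_mass B U"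
  unfolding total_mass_def sum_Pow_insert[OF assms] by simp

lemma cond_mean_split:
  assumes "B \<subseteq> E" "insert e U \<subseteq> E" "e \<notin> U"
  shows "cond_mean B (insert e U) F =
    (total_mass (insert e B) U * cond_mean (insert e B) U F + total_mass B U * cond_mean B U F)
      / (total_mass (insert e B) U + total_mass B U)"
proof -
  have "finite U"
    using assms(2) finite_edges by simp
  note split = total_mass_split[OF this assms(3)] sum_Pow_insert[OF this assms(3)]
  have "total_mass (insert e B) U \<noteq> 0" "total_mass B U \<noteq> 0"
    using assms total_mass_pos[of "insert e B" U] total_mass_pos[of B U] by auto
  then show ?thesis
    by (simp only: cond_mean_def split times_divide_eq_right nonzero_mult_div_cancel_left
        Un_insert_left Un_insert_right not_False_eq_True)
qed

lemma total_mass_insert: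
  assumes "e \<in> E" "B \<subseteq> E" "U \<subseteq> E" "e \<notin> B" "e \<notin> U"
  shows "total_mass (insert e B) U = total_mass B U * cond_mean B U (open_ratio e)"
proof -
  have "rc_mass (insert e B \<union> \<eta>) = open_ratio e (B \<union> \<eta>) * rc_mass (B \<union> \<eta>)" if "\<eta> \<subseteq> U" for \<eta>
    using rc_mass_insert[of e "B \<union> \<eta>"] that assms by auto
  then have "total_mass (insert e B) U = (\<Sum>\<eta>\<in>Pow U. rc_mass (B \<union> \<eta>) * open_ratio e (B \<union> \<eta>))"
    unfolding total_mass_def by (intro sum.cong) (auto simp: mult.commute)
  then show ?thesis
    using total_mass_pos[OF assms(2,3)] by (simp add: cond_mean_def)
qed

lemma weighted_average_le:
  fixes a b c d :: real
  assumes "0 < a" "0 < b" "0 < c" "0 < d" "a * d \<le> c * b"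
    and "y0 \<le> y1" "y1 \<le> x1" "y0 \<le> x0"
  shows "(a * y1 + b * y0) / (a + b) \<le> (c * x1 + d * x0) / (c + d)"
proof -
  have "(a * y1 + b * y0) / (a + b) = y0 + a / (a + b) * (y1 - y0)"
    using assms by (simp add: field_simps)
  also have "\<dots> \<le> y0 + c / (c + d) * (y1 - y0)"
    using assms by (intro add_left_mono mult_right_mono) (auto simp: field_simps)
  also have "\<dots> = (c * y1 + d * y0) / (c + d)"
    using assms by (simp add: field_simps)
  also have "\<dots> \<le> (c * x1 + d * x0) / (c + d)"
    using assms by (intro divide_right_mono add_mono mult_left_mono) auto
  finally show ?thesis .
qed

text \<open>
The common induction step for comparing the two states of an edge \<open>e\<close>: reveal a further edge \<open>e'\<close>.
It is more likely to be open if \<open>e\<close> is open, which is the assumption on masses; given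
its state, opening \<open>e\<close> raises the average; and opening \<open>e'\<close> raises it when \<open>e\<close> is closed.
\<close>

lemma cond_mean_insert_step:
  assumes sub: "B \<subseteq> E" "insert e' U \<subseteq> E" "e \<in> E" and "e' \<notin> U"
    and mass: "total_mass (insert e' B) U * total_mass (insert e B) U
      \<le> total_mass (insert e' (insert e B)) U * total_mass B U"
    and "cond_mean B U F \<le> cond_mean (insert e' B) U F"
    and "cond_mean B U F \<le> cond_mean (insert e B) U F"
    and "cond_mean (insert e' B) U F \<le> cond_mean (insert e' (insert e B)) U F"
  shows "cond_mean B (insert e' U) F \<le> cond_mean (insert e B) (insert e' U) F"
proof -
  have "0 < total_mass (insert e' B) U" "0 < total_mass B U"
    "0 < total_mass (insert e' (insert e B)) U" "0 < total_mass (insert e B) U"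
    using sub by (auto intro!: total_mass_pos)
  moreover have "insert e B \<subseteq> E"
    using sub by simp
  ultimately show ?thesis
    using assms by (simp add: cond_mean_split weighted_average_le)
qed

text \<open>
The odds of \<open>e'\<close> being open are the average of its opening ratio.
\<close>

lemma total_mass_supermodular_if_ratio_increasing:
  assumes "e \<in> E" "e' \<in> E" "B \<subseteq> E" "U \<subseteq> E" "e \<noteq> e'" "e' \<notin> B" "e' \<notin> U"
    and "cond_mean B U (open_ratio e') \<le> cond_mean (insert e B) U (open_ratio e')"
  shows "total_mass (insert e' B) U * total_mass (insert e B) U
      \<le> total_mass (insert e' (insert e B)) U * total_mass B U"
proof -
  have "0 < total_mass B U" "0 < total_mass (insert e B) U"
    using assms by (auto intro!: total_mass_pos)
  then show ?thesis
    using assms total_mass_insert[of e' "insert e B" U] total_mass_insert[of e' B U]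
    by (simp add: mult_ac)
qed

text \<open>
Positive association of the random cluster measure, in the form of monotonicity in the state of one
edge. The induction feeds itself: that opening \<open>e\<close> makes \<open>e'\<close> more likely is the claim for the increasing
function \<open>open_ratio e'\<close> and fewer undecided edges.
\<close>

lemma cond_mean_increasing:
  assumes "U \<subseteq> E" "B \<subseteq> E" "e \<in> E" "B \<inter> U = {}" "e \<notin> U"
    and "mono (h :: 'e set \<Rightarrow> real)"
  shows "cond_mean B U h \<le> cond_mean (insert e B) U h"
proof -
  have "finite U"
    using assms(1) by (rule finite_edges)
  then show ?thesis
    using assms
  proof (induction U arbitrary: B e h rule: finite_induct)
    case empty
    then show ?case
      using monoD[OF empty.prems(6), of B "insert e B"] by (auto simp: cond_mean_empty)
  next
    case (insert e' U)
    have "mono (open_ratio e')"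
      using insert.prems by (intro monoI open_ratio_mono) auto
    then have "cond_mean B U (open_ratio e') \<le> cond_mean (insert e B) U (open_ratio e')"
      using insert.prems by (intro insert.IH) auto
    then have "total_mass (insert e' B) U * total_mass (insert e B) U
        \<le> total_mass (insert e' (insert e B)) U * total_mass B U"
      using insert.prems insert.hyps by (intro total_mass_supermodular_if_ratio_increasing) auto
    moreover have "cond_mean (insert e' B) U h \<le> cond_mean (insert e (insert e' B)) U h"
      using insert.prems insert.hyps by (intro insert.IH) auto
    ultimately show ?case
      using insert.prems insert.hyps
      by (intro cond_mean_insert_step insert.IH) (auto simp: insert_commute)
  qed
qed

lemma total_mass_supermodular:
  assumes "e \<in> E" "e' \<in> E" "B \<subseteq> E" "U \<subseteq> E" "B \<inter> U = {}" "e \<noteq> e'" "e' \<notin> B" "e \<notin> U" "e' \<notin> U"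
  shows "total_mass (insert e' B) U * total_mass (insert e B) U
      \<le> total_mass (insert e' (insert e B)) U * total_mass B U"
  using assms
  by (intro total_mass_supermodular_if_ratio_increasing cond_mean_increasing)
     (auto intro!: monoI open_ratio_mono)


section \<open>The spin configuration seen from a plus root\<close>

text \<open>
The average spin functional given the open edges, with the spin of \<open>r\<close> conditioned to be plus, minus,
or left free. The first two are written as overwriting the spin of the cluster of \<open>r\<close>, by
\<open>spin_mean_split\<close>.
\<close>

definition plus_mean :: "real \<Rightarrow> 'v \<Rightarrow> ('v set \<Rightarrow> real) \<Rightarrow> 'e set \<Rightarrow> real" where
  "plus_mean \<alpha> r f \<omega> = spin_mean \<alpha> (comps \<omega>) (\<lambda>P. f (P \<union> comp \<omega> r))"

definition minus_mean :: "real \<Rightarrow> 'v \<Rightarrow> ('v set \<Rightarrow> real) \<Rightarrow> 'e set \<Rightarrow> real" where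
  "minus_mean \<alpha> r f \<omega> = spin_mean \<alpha> (comps \<omega>) (\<lambda>P. f (P - comp \<omega> r))"

definition free_mean :: "real \<Rightarrow> ('v set \<Rightarrow> real) \<Rightarrow> 'e set \<Rightarrow> real" where
  "free_mean \<alpha> f \<omega> = spin_mean \<alpha> (comps \<omega>) f"

lemma free_mean_split:
  assumes "r \<in> V"
  shows "free_mean \<alpha> f \<omega> = \<alpha> * plus_mean \<alpha> r f \<omega> + (1 - \<alpha>) * minus_mean \<alpha> r f \<omega>"
  unfolding free_mean_def plus_mean_def minus_mean_def
  by (rule spin_mean_split[OF finite_comps disjoint_comps]) (use assms in \<open>simp add: comps_eq\<close>)

lemma minus_mean_flip: "minus_mean \<alpha> r f \<omega> = plus_mean (1 - \<alpha>) r (\<lambda>P. f (V - P)) \<omega>"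
proof -
  have "V - P - C = V - (P \<union> C)" for P C
    by blast
  then show ?thesis
    unfolding minus_mean_def plus_mean_def
    by (subst spin_mean_flip[OF finite_comps disjoint_comps]) (simp add: Union_comps)
qed

lemma minus_mean_le_plus_mean:
  assumes "0 < \<alpha>" "\<alpha> < 1" "mono_on (Pow V) f"
  shows "minus_mean \<alpha> r f \<omega> \<le> plus_mean \<alpha> r f \<omega>"
  unfolding minus_mean_def plus_mean_def using comp_subset[of \<omega> r]
  by (intro spin_mean_mono mono_onD[OF assms(3)] assms(1,2)) (auto simp: Union_comps)

lemma comp_isolated:
  assumes "r \<in> V" "\<eta> \<subseteq> E" "\<And>e. e \<in> \<eta> \<Longrightarrow> ends e \<inter> comp B r = {}"
  shows "comp (B \<union> \<eta>) r = comp B r"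
proof -
  have "finite \<eta>"
    using assms(2) by (rule finite_edges)
  then show ?thesis
    using assms(2,3)
  proof (induction \<eta> rule: finite_induct)
    case (insert e \<eta>)
    then have IH: "comp (B \<union> \<eta>) r = comp B r"
      by auto
    obtain u v where uv: "u \<in> V" "v \<in> V" "ends e = {u, v}"
      using edge_ends insert.prems(1) by blast
    then have "u \<notin> comp B r" "v \<notin> comp B r"
      using insert.prems(2)[of e] by auto
    then have "r \<notin> comp (B \<union> \<eta>) u \<union> comp (B \<union> \<eta>) v"
      using IH comp_iff comp_self uv assms(1) by (metis UnE)
    then show ?case
      using comp_insert[OF uv(3,1,2) assms(1), of "B \<union> \<eta>"] IH by simp
  qed simp
qed

lemma plus_mean_insert:
  assumes "ends e = {x, u}" "x \<in> V" "u \<in> V" "r \<in> V" "x \<in> comp \<omega> r"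
  shows "plus_mean \<alpha> r f (insert e \<omega>) =
    spin_mean \<alpha> (comps \<omega>) (\<lambda>P. f (P \<union> (comp \<omega> r \<union> comp \<omega> u)))"
proof -
  let ?A = "comp \<omega> r \<union> comp \<omega> u"
  have x: "comp \<omega> x = comp \<omega> r"
    using comp_iff assms by metis
  have "comp (insert e \<omega>) r = ?A"
    using comp_insert[OF assms(1-4), of \<omega>] comp_self[OF assms(4), of \<omega>] x by simp
  moreover have "{D \<in> comps (insert e \<omega>). \<not> D \<subseteq> ?A} = {D \<in> comps \<omega>. \<not> D \<subseteq> ?A}"
    unfolding comps_insert[OF assms(1-3)] x by auto
  ultimately show ?thesis
    unfolding plus_mean_def
    using spin_mean_absorb[OF finite_comps, of \<alpha> "insert e \<omega>" f ?A]
      spin_mean_absorb[OF finite_comps, of \<alpha> \<omega> f ?A] by simp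
qed

text \<open>
A constant factor in the weights is lost in the normalisation.
\<close>

lemma cond_mean_tilt:
  assumes "c \<noteq> 0" "\<And>\<eta>. \<eta> \<subseteq> U \<Longrightarrow> rc_mass (B' \<union> \<eta>) = c * rc_mass (B \<union> \<eta>)"
    and "\<And>\<eta>. \<eta> \<subseteq> U \<Longrightarrow> F (B' \<union> \<eta>) = G (B \<union> \<eta>)"
  shows "cond_mean B' U F = cond_mean B U G"
proof -
  have "(\<Sum>\<eta>\<in>Pow U. rc_mass (B' \<union> \<eta>) * F (B' \<union> \<eta>)) =
      c * (\<Sum>\<eta>\<in>Pow U. rc_mass (B \<union> \<eta>) * G (B \<union> \<eta>))"
    unfolding sum_distrib_left by (intro sum.cong) (use assms in \<open>auto simp: mult.assoc\<close>)
  moreover have "total_mass B' U = c * total_mass B U"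
    unfolding total_mass_def sum_distrib_left by (intro sum.cong) (use assms in auto)
  ultimately show ?thesis
    using assms(1) by (simp add: cond_mean_def)
qed

text \<open>
Whether the other end of \<open>e\<close> is connected to \<open>r\<close> does not depend on the undecided edges, since none
of them touches the cluster of \<open>r\<close>. Opening \<open>e\<close> then rescales all weights by one factor, and the
only effect on the spins is to turn the cluster of the other end to plus.
\<close>

lemma plus_mean_open_isolated:
  assumes "0 < \<alpha>" "\<alpha> < 1" "mono_on (Pow V) f" "r \<in> V"
    and "U \<subseteq> E" "B \<subseteq> E" "e \<in> E" "e \<notin> B" "e \<notin> U" "ends e \<inter> comp B r \<noteq> {}"
    and isolated: "\<And>e'. e' \<in> U \<Longrightarrow> ends e' \<inter> comp B r = {}"
  shows "cond_mean B U (plus_mean \<alpha> r f) \<le> cond_mean (insert e B) U (plus_mean \<alpha> r f)"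
proof -
  obtain x u where xu: "x \<in> V" "u \<in> V" "ends e = {x, u}" "x \<in> comp B r"
  proof -
    obtain a b where ab: "a \<in> V" "b \<in> V" "ends e = {a, b}"
      using edge_ends[OF assms(7)] .
    then have "a \<in> comp B r \<or> b \<in> comp B r"
      using assms(10) by auto
    then show ?thesis
      using that[of a b] that[of b a] ab by (auto simp: insert_commute)
  qed
  have r: "comp (B \<union> \<eta>) r = comp B r" if "\<eta> \<subseteq> U" for \<eta>
    using comp_isolated[OF assms(4), of \<eta> B] that assms(5) isolated by blast
  have x: "comp (B \<union> \<eta>) x = comp B r" if "\<eta> \<subseteq> U" for \<eta>
    using r[OF that] comp_iff[OF assms(4) xu(1), of "B \<union> \<eta>"] xu(4) by simp
  let ?G = "\<lambda>\<omega>. spin_mean \<alpha> (comps \<omega>) (\<lambda>P. f (P \<union> (comp \<omega> r \<union> comp \<omega> u)))"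
  have "cond_mean B U (plus_mean \<alpha> r f) \<le> cond_mean B U ?G"
    unfolding plus_mean_def using comp_subset
    by (intro cond_mean_mono assms spin_mean_mono mono_onD[OF assms(3)])
       (auto simp: Union_comps subset_iff)
  also have "\<dots> = cond_mean (insert e B) U (plus_mean \<alpha> r f)"
  proof (rule cond_mean_tilt[symmetric])
    show "open_ratio e B \<noteq> 0"
      using open_ratio_pos[OF assms(7), of B] by simp
    fix \<eta> assume \<eta>: "\<eta> \<subseteq> U"
    have "open_ratio e (B \<union> \<eta>) = open_ratio e B"
      unfolding open_ratio_def ends_connected_iff[OF xu(3,1,2)]
      using x[OF \<eta>] x[of "{}"] by simp
    then show "rc_mass (insert e B \<union> \<eta>) = open_ratio e B * rc_mass (B \<union> \<eta>)"
      using rc_mass_insert[of e "B \<union> \<eta>"] \<eta> assms by auto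
    show "plus_mean \<alpha> r f (insert e B \<union> \<eta>) = ?G (B \<union> \<eta>)"
      using plus_mean_insert[OF xu(3,1,2) assms(4), of "B \<union> \<eta>"] xu(4) r[OF \<eta>] by simp
  qed
  finally show ?thesis .
qed

text \<open>
The heart of the proof. The claim concerns edges at the cluster of a plus root only; this class of
edges is preserved when further such edges are revealed, because the cluster can only grow.
\<close>

lemma plus_mean_open:
  assumes "0 < \<alpha>" "\<alpha> < 1" "mono_on (Pow V) f" "r \<in> V"
    and "U \<subseteq> E" "B \<subseteq> E" "B \<inter> U = {}" "e \<in> E" "e \<notin> B" "e \<notin> U" "ends e \<inter> comp B r \<noteq> {}"
  shows "cond_mean B U (plus_mean \<alpha> r f) \<le> cond_mean (insert e B) U (plus_mean \<alpha> r f)"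
  using assms(5-)
proof (induction "card U" arbitrary: U B e rule: less_induct)
  case less
  show ?case
  proof (cases "\<exists>e'\<in>U. ends e' \<inter> comp B r \<noteq> {}")
    case False
    then show ?thesis
      using less.prems by (intro plus_mean_open_isolated assms) auto
  next
    case True
    then obtain e' where e': "e' \<in> U" "ends e' \<inter> comp B r \<noteq> {}"
      by blast
    define U' where "U' = U - {e'}"
    have U: "U = insert e' U'" "e' \<notin> U'"
      using e' by (auto simp: U'_def)
    have "finite U"
      using less.prems by (intro finite_edges)
    then have smaller: "card U' < card U"
      unfolding U'_def using e'(1) by (intro card_Diff1_less)
    have "ends e \<inter> comp (insert e' B) r \<noteq> {}"
      using less.prems comp_mono[OF subset_insertI[of B e'], of r] by blast
    then have "cond_mean (insert e' B) U' (plus_mean \<alpha> r f)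
        \<le> cond_mean (insert e (insert e' B)) U' (plus_mean \<alpha> r f)"
      using less.prems U by (intro less.hyps smaller) auto
    moreover have "total_mass (insert e' B) U' * total_mass (insert e B) U'
        \<le> total_mass (insert e' (insert e B)) U' * total_mass B U'"
      using less.prems U by (intro total_mass_supermodular) auto
    ultimately show ?thesis
      unfolding U(1) using less.prems U e'(2)
      by (intro cond_mean_insert_step less.hyps smaller) (auto simp: insert_commute)
  qed
qed


section \<open>Positive correlation\<close>

lemma plus_correlation_step:
  assumes "0 < \<alpha>" "\<alpha> < 1" "mono_on (Pow V) f" "mono_on (Pow V) g" "r \<in> V"
    and "insert e U \<subseteq> E" "B \<subseteq> E" "B \<inter> insert e U = {}" "e \<notin> U" "ends e \<inter> comp B r \<noteq> {}"
    and open_correlation: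
      "cond_mean (insert e B) U (plus_mean \<alpha> r f) * cond_mean (insert e B) U (plus_mean \<alpha> r g)
      \<le> cond_mean (insert e B) U (plus_mean \<alpha> r (\<lambda>P. f P * g P))"
    and closed_correlation:
      "cond_mean B U (plus_mean \<alpha> r f) * cond_mean B U (plus_mean \<alpha> r g)
      \<le> cond_mean B U (plus_mean \<alpha> r (\<lambda>P. f P * g P))"
  shows "cond_mean B (insert e U) (plus_mean \<alpha> r f) * cond_mean B (insert e U) (plus_mean \<alpha> r g)
    \<le> cond_mean B (insert e U) (plus_mean \<alpha> r (\<lambda>P. f P * g P))"
proof -
  let ?a = "total_mass (insert e B) U" and ?b = "total_mass B U"
  define s where "s = ?a / (?a + ?b)"
  have pos: "0 < ?a" "0 < ?b"
    using assms(6,7) by (auto intro!: total_mass_pos)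
  have s: "0 \<le> s" "s \<le> 1" "1 - s = ?b / (?a + ?b)"
    using pos by (auto simp: s_def field_simps)
  have mix: "cond_mean B (insert e U) F = s * cond_mean (insert e B) U F + (1 - s) * cond_mean B U F"
    for F
    unfolding s(3) cond_mean_split[OF assms(7,6,9)] by (simp add: s_def add_divide_distrib)
  have dom: "cond_mean B U (plus_mean \<alpha> r h) \<le> cond_mean (insert e B) U (plus_mean \<alpha> r h)"
    if "mono_on (Pow V) h" for h
    using assms that by (intro plus_mean_open) auto
  show ?thesis
    unfolding mix using assms(3,4)
    by (intro mixture_correlation s dom open_correlation closed_correlation)
qed

text \<open>
Mixing over the spin of the root. The correlation inequality with a minus root is the one with a plus
root for \<open>1 - \<alpha>\<close> and the increasing functions \<open>\<lambda>P. - f (V - P)\<close> and \<open>\<lambda>P. - g (V - P)\<close>; the two signs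
cancel in their product.
\<close>

lemma free_correlation_from_plus:
  assumes "0 < \<alpha>" "\<alpha> < 1" "mono_on (Pow V) f" "mono_on (Pow V) g" "r \<in> V" "U \<subseteq> E" "B \<subseteq> E"
    and plus: "\<And>\<beta> f g. 0 < \<beta> \<Longrightarrow> \<beta> < 1 \<Longrightarrow> mono_on (Pow V) f \<Longrightarrow> mono_on (Pow V) g \<Longrightarrow>
      cond_mean B U (plus_mean \<beta> r f) * cond_mean B U (plus_mean \<beta> r g)
        \<le> cond_mean B U (plus_mean \<beta> r (\<lambda>P. f P * g P))"
  shows "cond_mean B U (free_mean \<alpha> f) * cond_mean B U (free_mean \<alpha> g)
    \<le> cond_mean B U (free_mean \<alpha> (\<lambda>P. f P * g P))"
proof -
  have split: "cond_mean B U (free_mean \<alpha> h) =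
      \<alpha> * cond_mean B U (plus_mean \<alpha> r h) + (1 - \<alpha>) * cond_mean B U (minus_mean \<alpha> r h)" for h
    unfolding cond_mean_linear[symmetric] by (rule cond_mean_cong) (rule free_mean_split[OF assms(5)])
  have dom: "cond_mean B U (minus_mean \<alpha> r h) \<le> cond_mean B U (plus_mean \<alpha> r h)"
    if "mono_on (Pow V) h" for h
    using assms that by (intro cond_mean_mono minus_mean_le_plus_mean) auto
  have "cond_mean B U (minus_mean \<alpha> r f) * cond_mean B U (minus_mean \<alpha> r g)
      \<le> cond_mean B U (minus_mean \<alpha> r (\<lambda>P. f P * g P))"
  proof -
    let ?f = "\<lambda>P. - f (V - P)" and ?g = "\<lambda>P. - g (V - P)"
    have mono: "mono_on (Pow V) (\<lambda>P. - h (V - P))" if "mono_on (Pow V) h" for h :: "'v set \<Rightarrow> real"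
      by (intro mono_onI le_imp_neg_le mono_onD[OF that]) auto
    have flip: "cond_mean B U (plus_mean (1 - \<alpha>) r (\<lambda>P. - h (V - P))) =
        - cond_mean B U (minus_mean \<alpha> r h)" for h
      unfolding cond_mean_uminus[symmetric] minus_mean_flip plus_mean_def spin_mean_uminus ..
    have "plus_mean (1 - \<alpha>) r (\<lambda>P. ?f P * ?g P) = minus_mean \<alpha> r (\<lambda>P. f P * g P)"
      by (simp add: fun_eq_iff minus_mean_flip)
    then show ?thesis
      using plus[of "1 - \<alpha>" ?f ?g] mono[OF assms(3)] mono[OF assms(4)] assms(1,2)
      by (simp add: flip)
  qed
  then show ?thesis
    unfolding split using assms(1-4) by (intro mixture_correlation dom plus) auto
qed

text \<open>
The two inequalities support each other. With a plus root whose cluster is touched by an undecided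
edge, the claim reduces to fewer undecided edges. The free claim reduces to this case for the same
edges, by choosing the root at an undecided edge. The remaining case of a plus root with an untouched
cluster reduces to the free claim, again for the same edges.
\<close>

lemma free_and_plus_correlation:
  assumes "0 < \<alpha>" "\<alpha> < 1" "mono_on (Pow V) f" "mono_on (Pow V) g" "U \<subseteq> E" "B \<subseteq> E" "B \<inter> U = {}"
  shows free_correlation: "cond_mean B U (free_mean \<alpha> f) * cond_mean B U (free_mean \<alpha> g)
      \<le> cond_mean B U (free_mean \<alpha> (\<lambda>P. f P * g P))" (is "?free \<alpha> U B f g")
    and plus_correlation: "r \<in> V \<Longrightarrow> cond_mean B U (plus_mean \<alpha> r f) * cond_mean B U (plus_mean \<alpha> r g)
      \<le> cond_mean B U (plus_mean \<alpha> r (\<lambda>P. f P * g P))" (is "_ \<Longrightarrow> ?plus \<alpha> U B f g r")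
proof -
  have "?free \<alpha> U B f g \<and> (\<forall>r\<in>V. ?plus \<alpha> U B f g r)"
    using assms
  proof (induction "card U" arbitrary: \<alpha> U B f g rule: less_induct)
    case less
    have "finite U"
      using less.prems by (intro finite_edges)
    \<comment> \<open>stated for all \<open>\<beta>\<close>, \<open>f\<close>, \<open>g\<close>, since the minus root needs \<open>1 - \<alpha>\<close> and flipped functions\<close>
    have touched: "?plus \<beta> U B f g r"
      if "e \<in> U" "ends e \<inter> comp B r \<noteq> {}" "r \<in> V" "0 < \<beta>" "\<beta> < 1"
        "mono_on (Pow V) f" "mono_on (Pow V) g" for \<beta> f g e r
    proof -
      define U' where "U' = U - {e}"
      have U: "U = insert e U'" "e \<notin> U'"
        using that(1) by (auto simp: U'_def)
      have smaller: "card U' < card U"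
        unfolding U'_def using \<open>finite U\<close> that(1) by (intro card_Diff1_less)
      have "?plus \<beta> U' (insert e B) f g r" "?plus \<beta> U' B f g r"
        using less.hyps[OF smaller that(4-7), of "insert e B"] less.hyps[OF smaller that(4-7), of B]
          less.prems(5-7) U that(3) by auto
      then show ?thesis
        unfolding U(1) using that U less.prems(5-7) by (intro plus_correlation_step) auto
    qed
    \<comment> \<open>stated for all \<open>f\<close>, \<open>g\<close>, since an untouched plus cluster of the root is absorbed into them\<close>
    have free: "?free \<alpha> U B f g" if "mono_on (Pow V) f" "mono_on (Pow V) g" for f g
    proof (cases "U = {}")
      case True
      show ?thesis
        unfolding True cond_mean_empty[OF less.prems(6)] free_mean_def
        using that less.prems(1,2)
        by (intro spin_mean_correlation[OF finite_comps, of _ V]) (auto simp: Union_comps)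
    next
      case False
      then obtain e where e: "e \<in> U"
        by blast
      then obtain r where r: "r \<in> V" "r \<in> ends e"
        using edge_ends[of e] less.prems(5) by blast
      then have "ends e \<inter> comp B r \<noteq> {}"
        using comp_self by blast
      then show ?thesis
        using that less.prems e r by (intro free_correlation_from_plus[of _ _ _ r] touched) auto
    qed
    moreover have "?plus \<alpha> U B f g r" if "r \<in> V" for r
    proof (cases "\<exists>e\<in>U. ends e \<inter> comp B r \<noteq> {}")
      case True
      then show ?thesis
        using touched that less.prems by blast
    next
      case False
      have "comp (B \<union> \<eta>) r = comp B r" if "\<eta> \<subseteq> U" for \<eta>
        using comp_isolated[OF \<open>r \<in> V\<close>, of \<eta> B] that False less.prems(5) by blast
      then have "cond_mean B U (plus_mean \<alpha> r h) =
          cond_mean B U (free_mean \<alpha> (\<lambda>P. h (P \<union> comp B r)))" for h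
        by (intro cond_mean_cong) (simp add: plus_mean_def free_mean_def)
      then show ?thesis
        using free[of "\<lambda>P. f (P \<union> comp B r)" "\<lambda>P. g (P \<union> comp B r)"] less.prems(3,4)
        by (simp add: mono_on_Un comp_subset)
    qed
    ultimately show ?case
      using less.prems(3,4) by blast
  qed
  then show "?free \<alpha> U B f g" and "r \<in> V \<Longrightarrow> ?plus \<alpha> U B f g r"
    by blast+
qed


section \<open>The fuzzy Potts measure as a random cluster average\<close>

definition open_edges :: "('e \<Rightarrow> nat) \<Rightarrow> 'e set" where
  "open_edges \<eta> = {e \<in> E. \<eta> e = 1}"

lemma connected_rel_eq: "connected_rel V E ends \<eta> = conn (open_edges \<eta>)"
proof -
  have "open_adj E ends \<eta> = open_adj (open_edges \<eta>) ends (\<lambda>_. Suc 0)"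
    by (auto simp: open_adj_def open_edges_def)
  then show ?thesis
    by (simp add: connected_rel_def)
qed

lemma rc_weight_eq:
  assumes "\<eta> \<in> edge_configs E"
  shows "rc_weight V E ends p q \<eta> = (\<Prod>e\<in>E. 1 - p e) * rc_mass (open_edges \<eta>)"
proof -
  have "p e ^ \<eta> e * (1 - p e) ^ (1 - \<eta> e) = (1 - p e) * (if \<eta> e = 1 then p e / (1 - p e) else 1)"
    if "e \<in> E" for e
    using that assms p[OF that] by (auto simp: edge_configs_def PiE_iff)
  then have "(\<Prod>e\<in>E. p e ^ \<eta> e * (1 - p e) ^ (1 - \<eta> e)) =
      (\<Prod>e\<in>E. 1 - p e) * (\<Prod>e\<in>E. if \<eta> e = 1 then p e / (1 - p e) else 1)"
    by (simp add: prod.distrib)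
  also have "(\<Prod>e\<in>E. if \<eta> e = 1 then p e / (1 - p e) else 1) =
      (\<Prod>e\<in>open_edges \<eta>. p e / (1 - p e))"
    unfolding open_edges_def using finite_edges[of E] by (simp add: prod.inter_filter)
  finally show ?thesis
    by (simp add: rc_weight_def rc_mass_def clusters_def connected_rel_eq)
qed

lemma sum_edge_configs:
  fixes F :: "'e set \<Rightarrow> real"
  shows "(\<Sum>\<eta>\<in>edge_configs E. F (open_edges \<eta>)) = (\<Sum>\<omega>\<in>Pow E. F \<omega>)"
  by (rule sum.reindex_bij_witness[of _ "\<lambda>\<omega>. \<lambda>e\<in>E. if e \<in> \<omega> then 1 else 0" open_edges])
     (auto simp: open_edges_def edge_configs_def PiE_iff extensional_def fun_eq_iff)

lemma random_cluster_average:
  "(\<Sum>\<eta>\<in>edge_configs E. pmf (random_cluster V E ends p q) \<eta> * F (open_edges \<eta>)) =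
    cond_mean {} E F"
proof -
  let ?c = "\<Prod>e\<in>E. 1 - p e"
  have "0 < ?c"
    using p by (auto intro!: prod_pos)
  have total: "(\<Sum>\<omega>\<in>edge_configs E. rc_weight V E ends p q \<omega>) = ?c * total_mass {} E"
    unfolding total_mass_def sum_distrib_left sum_edge_configs[symmetric]
    by (intro sum.cong) (simp_all add: rc_weight_eq)
  have "pmf (random_cluster V E ends p q) \<eta> * F (open_edges \<eta>) =
      rc_mass (open_edges \<eta>) * F (open_edges \<eta>) / total_mass {} E" if "\<eta> \<in> edge_configs E" for \<eta>
  proof -
    have "pmf (random_cluster V E ends p q) \<eta> = rc_weight V E ends p q \<eta> / (?c * total_mass {} E)"
      using that q p unfolding total[symmetric] by (subst pmf_random_cluster[OF graph]) auto
    then show ?thesis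
      using \<open>0 < ?c\<close> by (simp add: rc_weight_eq[OF that])
  qed
  then show ?thesis
    using sum_edge_configs[of "\<lambda>\<omega>. rc_mass \<omega> * F \<omega> / total_mass {} E"]
    by (simp add: cond_mean_def sum_divide_distrib)
qed

text \<open>
Averaging first over the spins given the clusters and then over the random cluster measure, with all
edges undecided.
\<close>

lemma fuzzy_potts_prob:
  assumes "0 < \<alpha>" "\<alpha> < 1"
  shows "measure_pmf.prob (fuzzy_potts V E ends (random_cluster V E ends p q) \<alpha>) A =
    cond_mean {} E (free_mean \<alpha> (\<lambda>P. indicator A (plus_config V P)))"
proof -
  let ?\<phi> = "random_cluster V E ends p q" and ?f = "\<lambda>P. indicat_real A (plus_config V P)"
  let ?spins = "\<lambda>\<eta>. Pi_pmf (clusters V E ends \<eta>) undefined (\<lambda>_. spin_pmf \<alpha>)"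
  let ?\<sigma> = "\<lambda>\<eta> s. \<lambda>v\<in>V. s (cluster V E ends \<eta> v)"
  have clusters_eq: "clusters V E ends \<eta> = comps (open_edges \<eta>)"
    "cluster V E ends \<eta> = comp (open_edges \<eta>)" for \<eta>
    by (auto simp: clusters_def cluster_def connected_rel_eq)
  have support: "set_pmf ?\<phi> \<subseteq> edge_configs E"
    using q by (auto simp: set_pmf_eq pmf_random_cluster[OF graph p] split: if_splits)
  have cond: "measure_pmf.expectation (map_pmf (?\<sigma> \<eta>) (?spins \<eta>)) (indicat_real A) =
      free_mean \<alpha> ?f (open_edges \<eta>)" for \<eta>
  proof -
    let ?\<omega> = "open_edges \<eta>"
    have "?\<sigma> \<eta> s = plus_config V (\<Union>{C \<in> comps ?\<omega>. s C = 1})" if s: "s \<in> set_pmf (?spins \<eta>)" for s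
    proof -
      \<comment> \<open>off the support, \<open>s\<close> could take other values, and a vertex that is not plus need not be minus\<close>
      have pm: "s C = 1 \<or> s C = -1" if "C \<in> comps ?\<omega>" for C
        using that s
        by (force simp: clusters_eq set_Pi_pmf[OF finite_comps] PiE_dflt_def spin_pmf_def)
      have "v \<in> \<Union>{C \<in> comps ?\<omega>. s C = 1} \<longleftrightarrow> s (comp ?\<omega> v) = 1" if "v \<in> V" for v
        using comp_iff[of _ v ?\<omega>] comp_self[of v ?\<omega>] that by (auto simp: comps_eq)
      then show ?thesis
        using pm by (force simp: plus_config_def clusters_eq comps_eq)
    qed
    then have "measure_pmf.expectation (map_pmf (?\<sigma> \<eta>) (?spins \<eta>)) (indicat_real A) =
        measure_pmf.expectation (?spins \<eta>) (\<lambda>s. ?f (\<Union>{C \<in> comps ?\<omega>. s C = 1}))"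
      unfolding integral_map_pmf by (intro integral_cong_AE) (auto simp: AE_measure_pmf_iff)
    then show ?thesis
      using expectation_cluster_spins[OF finite_comps assms, of ?\<omega> ?f]
      by (simp add: clusters_eq free_mean_def)
  qed
  have "measure_pmf.prob (fuzzy_potts V E ends ?\<phi> \<alpha>) A =
      measure_pmf.expectation (fuzzy_potts V E ends ?\<phi> \<alpha>) (indicat_real A)"
    by simp
  also have "\<dots> = (\<Sum>\<eta>\<in>edge_configs E. pmf ?\<phi> \<eta> * free_mean \<alpha> ?f (open_edges \<eta>))"
    unfolding fuzzy_potts_def cond[symmetric]
    by (subst pmf_expectation_bind[OF finite_edge_configs _ support])
       (auto simp: finite_edges clusters_eq finite_comps set_Pi_pmf spin_pmf_def
         intro!: finite_imageI finite_PiE_dflt)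
  also have "\<dots> = cond_mean {} E (free_mean \<alpha> ?f)"
    by (rule random_cluster_average)
  finally show ?thesis .
qed

lemma positively_associated_fuzzy_potts:
  assumes "0 < \<alpha>" "\<alpha> < 1"
  shows "positively_associated V (fuzzy_potts V E ends (random_cluster V E ends p q) \<alpha>)"
  unfolding positively_associated_def
proof (intro allI impI)
  fix A B assume "increasing_event V A" "increasing_event V B"
  then show "measure_pmf.prob (fuzzy_potts V E ends (random_cluster V E ends p q) \<alpha>) A *
      measure_pmf.prob (fuzzy_potts V E ends (random_cluster V E ends p q) \<alpha>) B
      \<le> measure_pmf.prob (fuzzy_potts V E ends (random_cluster V E ends p q) \<alpha>) (A \<inter> B)"
    unfolding fuzzy_potts_prob[OF assms] indicator_inter_arith
    by (intro free_correlation assms mono_on_indicator_plus_config) auto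
qed

end

theorem theorem1:
  fixes V :: "'v set" and E :: "'e set" and ends :: "'e \<Rightarrow> 'v set"
    and p :: "'e \<Rightarrow> real" and q \<alpha> :: real
  assumes "finite_graph V E ends"
    and "\<And>e. e \<in> E \<Longrightarrow> 0 < p e \<and> p e < 1"
    and "0 < \<alpha>" and "\<alpha> < 1"
    and "q \<ge> 1"
  shows "positively_associated V (fuzzy_potts V E ends (random_cluster V E ends p q) \<alpha>)"
proof -
  interpret random_cluster_graph V E ends p q
    using assms by unfold_locales
  show ?thesis
    using assms(3,4) by (rule positively_associated_fuzzy_potts)
qed

end
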